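(* Consider an instance of the MCST problem with $v_{j0}\neq0$ for all $j\in\mathcal N$, and the two optimization problems (P1) and (P2) below. (P1), in variables $\boldsymbol x=(x_j)$, $\boldsymbol y=(y_{ji})$: $$\max\ \sum_{j=1}^n\lambda_jr_jx_j+\sum_{j=1}^n\lambda_j(1-x_j)\frac{\sum_{i=1}^nr_iv_{ji}y_{ji}}{\sum_{i=1}^nv_{ji}y_{ji}+v_{j0}}$$ subject to $y_{ji}\le x_i$, $\ y_{ji}\le1-x_j$, $\ x_i,y_{ji}\in\{0,1\}$ for all $i,j=1,\dots,n$. (P2), in variables $\boldsymbol x=(x_j)$, $\boldsymbol z=(z_{ji})_{1\le j\le n,\,0\le i\le n}$: $$\max\ \sum_{j=1}^n\lambda_jr_jx_j+\sum_{j=1}^n\lambda_j\sum_{i=1}^nr_iz_{ji}$$ subject to $z_{ji}\le x_i$ for all $i,j=1,\dots,n$; $\ \sum_{i=1}^nz_{ji}+z_{j0}=1-x_j$ for all $j=1,\dots,n$; $\ 0\le z_{ji}\le\frac{v_{ji}}{v_{j0}}z_{j0}$ for all $i,j=1,\dots,n$; $\ x_i\in\{0,1\}$ for all $i=1,\dots,n$. If $(\boldsymbol x^*,\boldsymbol y^* )$ is an optimal solution to (P1), then there exists $\boldsymbol z^*$ such that $(\boldsymbol x^*,\boldsymbol z^* )$ is an optimal solution to (P2). Conversely, if $(\boldsymbol x^*,\boldsymbol z^* )$ is an optimal solution to (P2), then there exists $\boldsymbol y^*$ such that $(\boldsymbol x^*,\boldsymbol y^* )$ is an optimal solution to (P1).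 Furthermore, the optimal values of (P1) and (P2) are equal.
   Context: An instance of the MCST problem (assortment optimization under the Markov chain choice model with single transition) consists of products $\mathcal N=\{1,\dots,n\}$ with no-purchase option $0$; revenues $r_1\ge\cdots\ge r_n$ (real numbers); arrival probabilities $\lambda_j\ge0$ with $\sum_{j=1}^n\lambda_j=1$; and transition weights $v_{ji}\ge0$ for $j\in\mathcal N$, $i\in\mathcal N\cup\{0\}$ with $\sum_{i\in\mathcal N\cup\{0\}}v_{ji}=1$ for every $j$. (P1) is a formulation of the MCST problem, in which one chooses an offered assortment $S\subseteq\mathcal N$ and recommended sets $R_j\subseteq S$ for $j\notin S$ to maximize $\sum_{i\in S}\lambda_ir_i+\sum_{j\notin S}\lambda_j\frac{\sum_{i\in R_j}r_iv_{ji}}{\sum_{i\in R_j}v_{ji}+v_{j0}}$: $x_j=1$ means $j\in S$, and $y_{ji}=1$ means $i\in R_j$. The variables $z_{ji}$ are real. *)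

theory Defs
  imports Complex_Main "HOL-Library.Extended_Real"
begin

text \<open>
  Products are \<open>1, \<dots>, n\<close> and \<open>0\<close> is the no-purchase option; \<open>v j i\<close> is the weight of the transition
  from product \<open>j\<close> to option \<open>i\<close>. Vectors and matrices are total functions on \<^typ>\<open>nat\<close>; only the
  entries in the index ranges below are ever constrained or evaluated.
\<close>

definition mcst_instance ::
  "nat \<Rightarrow> (nat \<Rightarrow> real) \<Rightarrow> (nat \<Rightarrow> real) \<Rightarrow> (nat \<Rightarrow> nat \<Rightarrow> real) \<Rightarrow> bool" where
  "mcst_instance n r lam v \<longleftrightarrow>
     (\<forall>i\<in>{1..n}. \<forall>j\<in>{1..n}. i \<le> j \<longrightarrow> r i \<ge> r j) \<and>
     (\<forall>j\<in>{1..n}. 0 \<le> lam j) \<and>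
     (\<Sum>j=1..n. lam j) = 1 \<and>
     (\<forall>j\<in>{1..n}. \<forall>i\<in>{0..n}. 0 \<le> v j i) \<and>
     (\<forall>j\<in>{1..n}. (\<Sum>i=0..n. v j i) = 1)"

definition P1_objective ::
  "nat \<Rightarrow> (nat \<Rightarrow> real) \<Rightarrow> (nat \<Rightarrow> real) \<Rightarrow> (nat \<Rightarrow> nat \<Rightarrow> real) \<Rightarrow>
   (nat \<Rightarrow> real) \<times> (nat \<Rightarrow> nat \<Rightarrow> real) \<Rightarrow> real" where
  "P1_objective n r lam v = (\<lambda>(x, y).
     (\<Sum>j=1..n. lam j * r j * x j) +
     (\<Sum>j=1..n. lam j * (1 - x j) *
        ((\<Sum>i=1..n. r i * v j i * y j i) / ((\<Sum>i=1..n. v j i * y j i) + v j 0))))"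

definition P1_feasible :: "nat \<Rightarrow> (nat \<Rightarrow> real) \<times> (nat \<Rightarrow> nat \<Rightarrow> real) \<Rightarrow> bool" where
  "P1_feasible n = (\<lambda>(x, y).
     (\<forall>i\<in>{1..n}. \<forall>j\<in>{1..n}. y j i \<le> x i \<and> y j i \<le> 1 - x j \<and> x i \<in> {0, 1} \<and> y j i \<in> {0, 1}))"

definition P2_objective ::
  "nat \<Rightarrow> (nat \<Rightarrow> real) \<Rightarrow> (nat \<Rightarrow> real) \<Rightarrow>
   (nat \<Rightarrow> real) \<times> (nat \<Rightarrow> nat \<Rightarrow> real) \<Rightarrow> real" where
  "P2_objective n r lam = (\<lambda>(x, z).
     (\<Sum>j=1..n. lam j * r j * x j) + (\<Sum>j=1..n. lam j * (\<Sum>i=1..n. r i * z j i)))"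

definition P2_feasible ::
  "nat \<Rightarrow> (nat \<Rightarrow> nat \<Rightarrow> real) \<Rightarrow> (nat \<Rightarrow> real) \<times> (nat \<Rightarrow> nat \<Rightarrow> real) \<Rightarrow> bool" where
  "P2_feasible n v = (\<lambda>(x, z).
     (\<forall>i\<in>{1..n}. \<forall>j\<in>{1..n}. z j i \<le> x i) \<and>
     (\<forall>j\<in>{1..n}. (\<Sum>i=1..n. z j i) + z j 0 = 1 - x j) \<and>
     (\<forall>i\<in>{1..n}. \<forall>j\<in>{1..n}. 0 \<le> z j i \<and> z j i \<le> v j i / v j 0 * z j 0) \<and>
     (\<forall>i\<in>{1..n}. x i \<in> {0, 1}))"

text \<open>
  Taken in \<^typ>\<open>ereal\<close>, so that the supremum is meaningful without presupposing that the
  problem is feasible and bounded.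
\<close>

definition optimal_value :: "('a \<Rightarrow> real) \<Rightarrow> ('a \<Rightarrow> bool) \<Rightarrow> ereal" where
  "optimal_value f feas = (SUP s\<in>Collect feas. ereal (f s))"

end

theory Submission
  imports Defs
begin

text \<open>
  For a fixed assortment the two problems decouple over the products \<open>j\<close>, and the rows \<open>z j\<close> with
  \<open>x j = 0\<close> are the feasible points of a linear program. Its objective is the linearisation, by the
  substitution of Charnes and Cooper, of the fraction in (P1): \<open>z j i\<close> is the probability that a
  customer arriving for \<open>j\<close> ends up buying \<open>i\<close>, and the bounds say that the ratio of \<open>z j i\<close> to
  \<open>z j 0\<close> is at most that of \<open>v j i\<close> to \<open>v j 0\<close>. The recommended sets give those points for which
  every ratio is either zero or maximal. Hence each point of (P1) has a counterpart in (P2) with the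
  same assortment and the same value (\<open>P1_point_to_P2_point\<close>).

  Conversely, let \<open>\<theta>\<close> be the revenue of a row \<open>z j\<close> with \<open>x j = 0\<close>. Since the row is a probability
  distribution, \<open>(\<Sum>i. (r i - \<theta>) * z j i) = \<theta> * z j 0\<close>. Recommending exactly the offered products
  with \<open>r i \<ge> \<theta>\<close> raises the nonnegative terms to their upper bounds and drops the negative ones, so
  the fraction is at least \<open>\<theta>\<close> (\<open>threshold_ratio_ge\<close>). Rounding every row in this way never
  decreases the value (\<open>P2_point_to_P1_point\<close>).

  Thus each problem dominates the other assortment by assortment, and a mutual domination of this
  kind transfers optimal assortments and equates the optimal values.
\<close>

lemma arg_max_transfer:
  fixes f :: "'a \<times> 'b \<Rightarrow> real" and g :: "'a \<times> 'c \<Rightarrow> real"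
  assumes PQ: "\<And>x y. P (x, y) \<Longrightarrow> \<exists>z. Q (x, z) \<and> f (x, y) \<le> g (x, z)"
    and QP: "\<And>x z. Q (x, z) \<Longrightarrow> \<exists>y. P (x, y) \<and> g (x, z) \<le> f (x, y)"
    and opt: "is_arg_max f P (x, y)"
  shows "\<exists>z. is_arg_max g Q (x, z)"
proof -
  from opt have "P (x, y)" and max: "\<And>s. P s \<Longrightarrow> f s \<le> f (x, y)"
    by (auto simp: is_arg_max_def not_less)
  then obtain z where z: "Q (x, z)" "f (x, y) \<le> g (x, z)"
    using PQ by blast
  have "g s \<le> g (x, z)" if "Q s" for s
    using QP[of "fst s" "snd s"] that max z(2) by force
  with z(1) have "is_arg_max g Q (x, z)"
    by (auto simp: is_arg_max_def not_less)
  then show ?thesis ..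
qed

lemma optimal_value_mono:
  assumes "\<And>s. P s \<Longrightarrow> \<exists>t. Q t \<and> f s \<le> g t"
  shows "optimal_value f P \<le> optimal_value g Q"
  unfolding optimal_value_def using assms by (intro SUP_mono) force

lemma P1_point_to_P2_point:
  assumes v: "\<And>j i. j \<in> {1..n} \<Longrightarrow> i \<in> {1..n} \<Longrightarrow> 0 \<le> v j i"
    and v0: "\<And>j. j \<in> {1..n} \<Longrightarrow> 0 < v j 0"
    and feas: "P1_feasible n (x, y)"
  shows "\<exists>z. P2_feasible n v (x, z) \<and> P1_objective n r lam v (x, y) = P2_objective n r lam (x, z)"
proof -
  define D where "D j = (\<Sum>i=1..n. v j i * y j i) + v j 0" for j
  define z where "z j i = (1 - x j) * ((if i = 0 then v j 0 else v j i * y j i) / D j)" for j i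
  have x01: "x i \<in> {0, 1}" if "i \<in> {1..n}" for i
    using feas that by (auto simp: P1_feasible_def)
  have y: "y j i \<in> {0, 1}" "y j i \<le> x i" if "j \<in> {1..n}" "i \<in> {1..n}" for j i
    using feas that by (auto simp: P1_feasible_def)
  have vy: "0 \<le> v j i * y j i" "v j i * y j i \<le> v j i" if "j \<in> {1..n}" "i \<in> {1..n}" for j i
    using y(1)[OF that] v[OF that] by auto
  have D_ge: "v j i * y j i + v j 0 \<le> D j" if "j \<in> {1..n}" "i \<in> {1..n}" for j i
    unfolding D_def using member_le_sum[of i "{1..n}" "\<lambda>i. v j i * y j i"] vy that by auto
  have D_pos: "0 < D j" if "j \<in> {1..n}" for j
    using D_ge[OF that that] vy(1)[OF that that] v0[OF that] by linarith
  have z_le_x: "z j i \<le> x i" if "j \<in> {1..n}" "i \<in> {1..n}" for j i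
  proof (cases "x i = 0")
    case True
    then have "y j i = 0" using y[OF that] by auto
    then show ?thesis using True that by (simp add: z_def)
  next
    case False
    then have "x i = 1" using x01 that by blast
    moreover have "v j i * y j i / D j \<le> 1"
      using D_ge[OF that] v0[OF that(1)] D_pos[OF that(1)] by (simp add: divide_le_eq)
    ultimately show ?thesis using x01[OF that(1)] that by (auto simp: z_def)
  qed
  have z_bounds: "0 \<le> z j i \<and> z j i \<le> v j i / v j 0 * z j 0"
    if "j \<in> {1..n}" "i \<in> {1..n}" for j i
  proof -
    have "v j i * y j i / D j \<le> v j i / D j"
      using vy(2)[OF that] D_pos[OF that(1)] by (simp add: divide_right_mono)
    then show ?thesis
      using x01[OF that(1)] vy(1)[OF that] v0[OF that(1)] D_pos[OF that(1)] that
      by (auto simp: z_def)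
  qed
  have z_sum: "(\<Sum>i=1..n. z j i) + z j 0 = 1 - x j" if "j \<in> {1..n}" for j
  proof -
    have "(\<Sum>i=1..n. z j i) = (1 - x j) * ((\<Sum>i=1..n. v j i * y j i) / D j)"
      unfolding sum_divide_distrib sum_distrib_left by (rule sum.cong) (auto simp: z_def)
    then have "(\<Sum>i=1..n. z j i) + z j 0 =
        (1 - x j) * (((\<Sum>i=1..n. v j i * y j i) + v j 0) / D j)"
      by (simp add: z_def add_divide_distrib distrib_left)
    then show ?thesis
      unfolding D_def[of j, symmetric] using D_pos[OF that] by simp
  qed
  have revenue: "lam j * (1 - x j) * ((\<Sum>i=1..n. r i * v j i * y j i) / D j) =
      lam j * (\<Sum>i=1..n. r i * z j i)" for j
    unfolding sum_divide_distrib sum_distrib_left by (rule sum.cong) (auto simp: z_def)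
  have "P2_feasible n v (x, z)"
    using z_le_x z_sum z_bounds x01 unfolding P2_feasible_def by blast
  moreover have "P1_objective n r lam v (x, y) = P2_objective n r lam (x, z)"
    using revenue by (simp add: P1_objective_def P2_objective_def D_def)
  ultimately show ?thesis by blast
qed

text \<open>
  A maximum of a ratio is at least \<open>\<theta>\<close> as soon as the numerator minus \<open>\<theta>\<close> times the denominator
  can be made nonnegative, and that difference is separable: it is largest when \<open>i\<close> is selected
  precisely if \<open>r i \<ge> \<theta>\<close>. The distribution \<open>z\<close> certifies that its largest value is nonnegative.
\<close>

lemma threshold_ratio_ge:
  fixes r w x z :: "'i \<Rightarrow> real" and w0 z0 :: real
  assumes w: "\<And>i. i \<in> A \<Longrightarrow> 0 \<le> w i" and w0: "0 < w0"
    and x: "\<And>i. i \<in> A \<Longrightarrow> x i \<in> {0, 1}"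
    and z: "\<And>i. i \<in> A \<Longrightarrow> 0 \<le> z i" "\<And>i. i \<in> A \<Longrightarrow> z i \<le> x i"
    and ratio: "\<And>i. i \<in> A \<Longrightarrow> z i \<le> w i / w0 * z0"
    and total: "(\<Sum>i\<in>A. z i) + z0 = 1"
  defines "\<theta> \<equiv> \<Sum>i\<in>A. r i * z i"
  defines "y \<equiv> \<lambda>i. of_bool (x i = 1 \<and> \<theta> \<le> r i)"
  shows "\<theta> \<le> (\<Sum>i\<in>A. r i * w i * y i) / ((\<Sum>i\<in>A. w i * y i) + w0)"
proof -
  \<comment> \<open>If \<open>z0 \<le> 0\<close>, the ratio bounds would force \<open>z\<close> to vanish and the total to be at most 0.\<close>
  have z0: "0 < z0"
  proof (rule ccontr)
    assume "\<not> 0 < z0"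
    then have "z i \<le> 0" if "i \<in> A" for i
      using ratio[OF that] w[OF that] w0 mult_nonneg_nonpos[of "w i / w0" z0] by auto
    then have "(\<Sum>i\<in>A. z i) \<le> 0" by (rule sum_nonpos)
    with total \<open>\<not> 0 < z0\<close> show False by linarith
  qed
  have "\<theta> * z0 = \<theta> - \<theta> * (\<Sum>i\<in>A. z i)"
    using total by (simp add: algebra_simps flip: distrib_left)
  also have "\<dots> = (\<Sum>i\<in>A. (r i - \<theta>) * z i)"
    unfolding \<theta>_def[symmetric]
    by (simp add: left_diff_distrib sum_subtractf flip: sum_distrib_left \<theta>_def)
  also have "\<dots> \<le> (\<Sum>i\<in>A. (r i - \<theta>) * (w i / w0 * z0 * y i))"
  proof (rule sum_mono)
    fix i assume i: "i \<in> A"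
    show "(r i - \<theta>) * z i \<le> (r i - \<theta>) * (w i / w0 * z0 * y i)"
    proof (cases "x i = 1")
      case True
      then show ?thesis
        using z(1)[OF i] ratio[OF i]
        by (auto simp: y_def intro: mult_left_mono mult_nonpos_nonneg
            simp del: times_divide_eq_right times_divide_eq_left)
    next
      case False
      then show ?thesis using x[OF i] z[OF i] by (auto simp: y_def)
    qed
  qed
  also have "\<dots> = (\<Sum>i\<in>A. (r i - \<theta>) * w i * y i) / w0 * z0"
    unfolding sum_divide_distrib sum_distrib_right by (rule sum.cong) auto
  finally have "\<theta> * w0 \<le> (\<Sum>i\<in>A. (r i - \<theta>) * w i * y i)"
    using z0 w0 by (simp add: pos_le_divide_eq)
  also have "\<dots> = (\<Sum>i\<in>A. r i * w i * y i) - \<theta> * (\<Sum>i\<in>A. w i * y i)"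
    by (simp add: algebra_simps sum_subtractf sum_distrib_left)
  finally have "\<theta> * ((\<Sum>i\<in>A. w i * y i) + w0) \<le> (\<Sum>i\<in>A. r i * w i * y i)"
    by (simp add: algebra_simps)
  moreover have "0 < (\<Sum>i\<in>A. w i * y i) + w0"
    using w w0 by (intro add_nonneg_pos sum_nonneg) (auto simp: y_def)
  ultimately show ?thesis by (simp add: pos_le_divide_eq)
qed

lemma P2_point_to_P1_point:
  assumes lam: "\<And>j. j \<in> {1..n} \<Longrightarrow> 0 \<le> lam j"
    and v: "\<And>j i. j \<in> {1..n} \<Longrightarrow> i \<in> {1..n} \<Longrightarrow> 0 \<le> v j i"
    and v0: "\<And>j. j \<in> {1..n} \<Longrightarrow> 0 < v j 0"
    and feas: "P2_feasible n v (x, z)"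
  shows "\<exists>y. P1_feasible n (x, y) \<and> P2_objective n r lam (x, z) \<le> P1_objective n r lam v (x, y)"
proof -
  define y :: "nat \<Rightarrow> nat \<Rightarrow> real"
    where "y j i = of_bool (x j = 0 \<and> x i = 1 \<and> (\<Sum>k=1..n. r k * z j k) \<le> r i)" for j i
  have x: "x i \<in> {0, 1}" if "i \<in> {1..n}" for i
    using feas that by (auto simp: P2_feasible_def)
  have z: "0 \<le> z j i" "z j i \<le> x i" "z j i \<le> v j i / v j 0 * z j 0"
    if "j \<in> {1..n}" "i \<in> {1..n}" for j i
    using feas that by (auto simp: P2_feasible_def)
  have total: "(\<Sum>i=1..n. z j i) + z j 0 = 1 - x j" if "j \<in> {1..n}" for j
    using feas that by (auto simp: P2_feasible_def)
  have "P1_feasible n (x, y)"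
    using x by (fastforce simp: P1_feasible_def y_def)
  moreover have "lam j * (\<Sum>i=1..n. r i * z j i) \<le> lam j * (1 - x j) *
      ((\<Sum>i=1..n. r i * v j i * y j i) / ((\<Sum>i=1..n. v j i * y j i) + v j 0))"
    if j: "j \<in> {1..n}" for j
  proof (cases "x j = 0")
    case True
    have "(\<Sum>i=1..n. r i * z j i) \<le>
        (\<Sum>i=1..n. r i * v j i * y j i) / ((\<Sum>i=1..n. v j i * y j i) + v j 0)"
      using threshold_ratio_ge[of "{1..n}" "v j" "v j 0" x "z j" "z j 0" r]
        v v0 x z total[OF j] j True by (simp add: y_def)
    then show ?thesis
      using lam[OF j] True by (simp add: mult_left_mono del: times_divide_eq_right)
  next
    case False
    then have [simp]: "x j = 1" using x[OF j] by auto
    \<comment> \<open>The total of the row is now 0, so \<open>z j 0\<close> is nonpositive and the row vanishes.\<close>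
    have "0 \<le> (\<Sum>i=1..n. z j i)" using z(1)[OF j] by (intro sum_nonneg)
    then have "z j 0 \<le> 0" using total[OF j] by simp
    then have "z j i = 0" if "i \<in> {1..n}" for i
      using z(1,3)[OF j that] v[OF j that] v0[OF j]
        mult_nonneg_nonpos[of "v j i / v j 0" "z j 0"] by auto
    then show ?thesis by simp
  qed
  then have "P2_objective n r lam (x, z) \<le> P1_objective n r lam v (x, y)"
    unfolding P1_objective_def P2_objective_def prod.case by (intro add_left_mono sum_mono)
  ultimately show ?thesis by blast
qed

theorem theorem7:
  fixes n :: nat
    and r lam :: "nat \<Rightarrow> real"
    and v :: "nat \<Rightarrow> nat \<Rightarrow> real"
  assumes "mcst_instance n r lam v"
    and "\<forall>j\<in>{1..n}. v j 0 \<noteq> 0"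
  shows "(\<forall>x y. is_arg_max (P1_objective n r lam v) (P1_feasible n) (x, y) \<longrightarrow>
            (\<exists>z. is_arg_max (P2_objective n r lam) (P2_feasible n v) (x, z))) \<and>
         (\<forall>x z. is_arg_max (P2_objective n r lam) (P2_feasible n v) (x, z) \<longrightarrow>
            (\<exists>y. is_arg_max (P1_objective n r lam v) (P1_feasible n) (x, y))) \<and>
         optimal_value (P1_objective n r lam v) (P1_feasible n) =
           optimal_value (P2_objective n r lam) (P2_feasible n v)"
proof -
  have lam: "0 \<le> lam j" if "j \<in> {1..n}" for j
    using assms(1) that by (auto simp: mcst_instance_def)
  have v: "0 \<le> v j i" if "j \<in> {1..n}" "i \<in> {1..n}" for j i
    using assms(1) that by (auto simp: mcst_instance_def)
  have v0: "0 < v j 0" if "j \<in> {1..n}" for j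
    using assms that by (auto simp: mcst_instance_def order.strict_iff_order)
  have PQ: "\<exists>z. P2_feasible n v (x, z) \<and>
      P1_objective n r lam v (x, y) \<le> P2_objective n r lam (x, z)"
    if "P1_feasible n (x, y)" for x y
    using P1_point_to_P2_point[of n v x y r lam] v v0 that by auto
  have QP: "\<exists>y. P1_feasible n (x, y) \<and>
      P2_objective n r lam (x, z) \<le> P1_objective n r lam v (x, y)"
    if "P2_feasible n v (x, z)" for x z
    using P2_point_to_P1_point[of n lam v x z r] lam v v0 that by auto
  have "optimal_value (P1_objective n r lam v) (P1_feasible n) =
      optimal_value (P2_objective n r lam) (P2_feasible n v)"
  proof (rule antisym; rule optimal_value_mono)
    show "\<exists>t. P2_feasible n v t \<and> P1_objective n r lam v s \<le> P2_objective n r lam t"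
      if "P1_feasible n s" for s
      using PQ[of "fst s" "snd s"] that by auto
    show "\<exists>t. P1_feasible n t \<and> P2_objective n r lam s \<le> P1_objective n r lam v t"
      if "P2_feasible n v s" for s
      using QP[of "fst s" "snd s"] that by auto
  qed
  then show ?thesis
    using arg_max_transfer[OF PQ QP] arg_max_transfer[OF QP PQ] by blast
qed

end
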